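(* Let $G$ be a group. Then the commutator interchange law $$[w,x;y,z]=[w,y;x,z]\quad\text{for all } w,x,y,z\in G$$ holds in $G$ if and only if $G$ is 3-metabelian and every commutator of the form $[w,x;y,z]$ with $w,x,y,z\in G$ is either trivial or of order $2$. In other words, for groups the law $[w,x;y,z]=[w,y;x,z]$ is logically equivalent to the pair of laws $[x,y;x,z]=1$ and $[w,x;y,z]^2=1$ taken together (all variables ranging over all elements of the group).
   Context: For elements of a group, $[x,y]=x^{-1}y^{-1}xy$ and $[w,x;y,z]=[[w,x],[y,z]]$. A group is metabelian if its second derived group is trivial. A group $G$ is 3-metabelian if every subgroup generated by three elements is metabelian; by a known theorem of I. D. Macdonald this is equivalent to $G$ satisfying the law $[x,y;x,z]=1$ for all $x,y,z\in G$. *)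

theory Defs
  imports "HOL-Algebra.Algebra"
begin

text \<open>The convention is $[x,y] = x^{-1} y^{-1} x y$; the commutators in \<^const>\<open>derived\<close> are written
  $x y x^{-1} y^{-1}$ instead, which yields the same derived subgroup.\<close>

definition commutator :: "('a, 'b) monoid_scheme \<Rightarrow> 'a \<Rightarrow> 'a \<Rightarrow> 'a" where
  "commutator G x y = inv\<^bsub>G\<^esub> x \<otimes>\<^bsub>G\<^esub> inv\<^bsub>G\<^esub> y \<otimes>\<^bsub>G\<^esub> x \<otimes>\<^bsub>G\<^esub> y"

text \<open>\<open>commutator4 G w x y z\<close> is $[w,x;y,z]$.\<close>

definition commutator4 :: "('a, 'b) monoid_scheme \<Rightarrow> 'a \<Rightarrow> 'a \<Rightarrow> 'a \<Rightarrow> 'a \<Rightarrow> 'a" where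
  "commutator4 G w x y z = commutator G (commutator G w x) (commutator G y z)"

definition metabelian :: "('a, 'b) monoid_scheme \<Rightarrow> bool" where
  "metabelian G \<longleftrightarrow> derived G (derived G (carrier G)) = {\<one>\<^bsub>G\<^esub>}"

definition three_metabelian :: "('a, 'b) monoid_scheme \<Rightarrow> bool" where
  "three_metabelian G \<longleftrightarrow>
     (\<forall>x\<in>carrier G. \<forall>y\<in>carrier G. \<forall>z\<in>carrier G.
        metabelian (G\<lparr>carrier := generate G {x, y, z}\<rparr>))"

definition interchange_law :: "('a, 'b) monoid_scheme \<Rightarrow> bool" where
  "interchange_law G \<longleftrightarrow>
     (\<forall>w\<in>carrier G. \<forall>x\<in>carrier G. \<forall>y\<in>carrier G. \<forall>z\<in>carrier G.
        commutator4 G w x y z = commutator4 G w y x z)"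

end

theory Submission
  imports Defs
begin

text \<open>
  The law \<open>[x,y;x,z] = 1\<close> says that the commutators \<open>[w,g]\<close> with a fixed first entry \<open>w\<close> commute
  with one another. They generate a normal subgroup \<open>N\<^sub>w = [w,G]\<close>, because
  \<open>[w,g]\<^sup>h = [w,h]\<^sup>-\<^sup>1[w,gh]\<close>, so the law holds if and only if every \<open>N\<^sub>w\<close> is an abelian normal
  subgroup. As \<open>[w,x]\<close> lies in both \<open>N\<^sub>w\<close> and \<open>N\<^sub>x\<close>, two consequences follow.

  First, \<open>G\<close> is 3-metabelian: modulo the conjugates of \<open>[x,y]\<close>, \<open>[y,z]\<close> and \<open>[z,x]\<close> the elements
  \<open>x, y, z\<close> commute, and any two of these conjugates lie in a common \<open>N\<^sub>w\<close> since two pairs of letters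
  out of three share a letter. Hence the derived subgroup of \<open>\<langle>x,y,z\<rangle>\<close> is abelian
  (\<open>law_imp_three_metabelian\<close>). The converse is immediate.

  Second, a commutator is bilinear on a product of two abelian normal subgroups, in particular on
  \<open>N\<^sub>x \<times> N\<^sub>y\<close>. Thus \<open>[w,x;y,z]\<close> is inverted when \<open>w\<close> and \<open>x\<close> are exchanged, and expanding
  \<open>[xw,y;xw,z] = 1\<close> leaves only two factors and shows that it is inverted when \<open>w\<close> and \<open>y\<close> are
  exchanged. Composing such exchanges gives \<open>[w,x;y,z] = [w,y;x,z]\<^sup>-\<^sup>1\<close> (\<open>commutator4_interchange\<close>).
  So under the law \<open>[x,y;x,z] = 1\<close> the interchange law is the same as \<open>[w,x;y,z]\<^sup>2 = 1\<close>; and the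
  interchange law itself implies \<open>[x,y;x,z] = [x,x;y,z] = 1\<close>.
\<close>

section \<open>Commutator calculus\<close>

context group
begin

lemma inv_mult_cancel:
  assumes "a \<in> carrier G" "b \<in> carrier G"
  shows "inv a \<otimes> (a \<otimes> b) = b" "a \<otimes> (inv a \<otimes> b) = b"
  using assms by (simp_all add: m_assoc[symmetric])

lemmas word_simps = commutator_def m_assoc inv_mult_group inv_mult_cancel

lemma commutator_closed [simp]:
  "x \<in> carrier G \<Longrightarrow> y \<in> carrier G \<Longrightarrow> commutator G x y \<in> carrier G"
  by (simp add: commutator_def)

lemma commutator_eq_one_iff:
  assumes "x \<in> carrier G" "y \<in> carrier G"
  shows "commutator G x y = \<one> \<longleftrightarrow> x \<otimes> y = y \<otimes> x"
proof -
  have "commutator G x y = inv (y \<otimes> x) \<otimes> (x \<otimes> y)"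
    using assms by (simp add: word_simps)
  then show ?thesis
    using assms by (metis inv_closed inv_inv inv_equality l_inv m_closed)
qed

lemma inv_commutator:
  assumes "x \<in> carrier G" "y \<in> carrier G"
  shows "inv (commutator G x y) = commutator G y x"
  using assms by (simp add: word_simps)

lemma commutator_mult_left:
  assumes "x \<in> carrier G" "y \<in> carrier G" "z \<in> carrier G"
  shows "commutator G (x \<otimes> y) z = inv y \<otimes> commutator G x z \<otimes> y \<otimes> commutator G y z"
  using assms by (simp add: word_simps)

lemma commutator_inv_left:
  assumes "x \<in> carrier G" "z \<in> carrier G"
  shows "commutator G (inv x) z = x \<otimes> inv (commutator G x z) \<otimes> inv x"
  using assms by (simp add: word_simps)

lemma commutator_one_left: "z \<in> carrier G \<Longrightarrow> commutator G \<one> z = \<one>"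
  by (simp add: word_simps)

lemma commutator_in_normal_left:
  assumes "N \<lhd> G" "a \<in> N" "g \<in> carrier G"
  shows "commutator G a g \<in> N"
proof -
  interpret N: normal N G by fact
  have "inv a \<otimes> (inv g \<otimes> a \<otimes> g) \<in> N"
    using assms by (simp add: N.inv_op_closed1)
  then show ?thesis
    using assms by (simp add: word_simps N.mem_carrier)
qed

text \<open>The elements commuting modulo \<open>N\<close> with a given set form a subgroup, so commuting modulo \<open>N\<close>
  passes from generators to the subgroup in one argument and then, by symmetry, in the other.\<close>

lemma commutator_generate_in_normal:
  assumes "N \<lhd> G" and S: "S \<subseteq> carrier G"
    and comm: "\<And>s t. s \<in> S \<Longrightarrow> t \<in> S \<Longrightarrow> commutator G s t \<in> N"
    and "g \<in> generate G S" "h \<in> generate G S"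
  shows "commutator G g h \<in> N"
proof -
  interpret N: normal N G by fact
  have gen: "commutator G u t \<in> N"
    if u: "u \<in> generate G S" and t: "t \<in> carrier G"
      and base: "\<And>s. s \<in> S \<Longrightarrow> commutator G s t \<in> N" for u t
    using u
  proof induction
    case one
    then show ?case using t by (simp add: commutator_one_left)
  next
    case (incl s)
    then show ?case by (rule base)
  next
    case (inv s)
    then have "s \<in> carrier G" "commutator G s t \<in> N" using S base by auto
    then show ?case
      using t by (simp add: commutator_inv_left N.inv_op_closed2)
  next
    case (eng u v)
    then have "u \<in> carrier G" "v \<in> carrier G"
      using generate_in_carrier[OF S] by auto
    then show ?case
      using eng.IH t by (simp add: commutator_mult_left N.inv_op_closed1)
  qed
  have h: "h \<in> carrier G" using generate_in_carrier[OF S] assms by blast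
  have "commutator G s h \<in> N" if s: "s \<in> S" for s
  proof -
    have "commutator G h s \<in> N"
      using gen s S comm assms(5) by blast
    then show ?thesis
      using N.m_inv_closed inv_commutator h s S by (metis subsetD)
  qed
  then show ?thesis using gen assms(4) h by blast
qed

lemma trivial_normal: "{\<one>} \<lhd> G"
  by (rule normal_invI[OF triv_subgroup]) simp

lemma derived_generate_subset_normal:
  assumes "N \<lhd> G" "S \<subseteq> carrier G"
    and "\<And>s t. s \<in> S \<Longrightarrow> t \<in> S \<Longrightarrow> commutator G s t \<in> N"
  shows "derived G (generate G S) \<subseteq> N"
  unfolding derived_def
proof (rule generate_subgroup_incl)
  show "subgroup N G" using assms(1) by (simp add: normal_imp_subgroup)
  show "derived_set G (generate G S) \<subseteq> N"
  proof
    fix k assume "k \<in> derived_set G (generate G S)"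
    then obtain g h where gh: "g \<in> generate G S" "h \<in> generate G S"
      and k: "k = g \<otimes> h \<otimes> inv g \<otimes> inv h" by blast
    \<comment> \<open>The generators of the derived subgroup are written \<open>g h g\<^sup>-\<^sup>1 h\<^sup>-\<^sup>1 = [g\<^sup>-\<^sup>1,h\<^sup>-\<^sup>1]\<close>.\<close>
    have "commutator G (inv g) (inv h) \<in> N"
      using gh assms(2)
      by (intro commutator_generate_in_normal[OF assms]) (simp_all add: generate_m_inv_closed)
    moreover have "g \<in> carrier G" "h \<in> carrier G"
      using gh generate_in_carrier[OF assms(2)] by auto
    ultimately show "k \<in> N"
      by (simp add: k commutator_def)
  qed
qed

section \<open>Bilinearity on abelian normal subgroups\<close>

definition abelian_normal :: "'a set \<Rightarrow> bool" where
  "abelian_normal N \<longleftrightarrow> N \<lhd> G \<and> (\<forall>a\<in>N. \<forall>b\<in>N. commutator G a b = \<one>)"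

lemma abelian_normal_carrier: "abelian_normal N \<Longrightarrow> a \<in> N \<Longrightarrow> a \<in> carrier G"
  unfolding abelian_normal_def by (meson normal_imp_subgroup subgroup.mem_carrier)

lemma abelian_normal_commute:
  "abelian_normal N \<Longrightarrow> a \<in> N \<Longrightarrow> b \<in> N \<Longrightarrow> a \<otimes> b = b \<otimes> a"
  using abelian_normal_carrier commutator_eq_one_iff unfolding abelian_normal_def by metis

lemma abelian_normal_commutator:
  "abelian_normal N \<Longrightarrow> a \<in> N \<Longrightarrow> g \<in> carrier G \<Longrightarrow> commutator G a g \<in> N"
  using commutator_in_normal_left unfolding abelian_normal_def by blast

text \<open>\<open>[ab,g] = [a,g]\<^sup>b[b,g]\<close>, and \<open>b\<close> commutes with \<open>[a,g]\<close>, which normality keeps inside \<open>N\<close>.\<close>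

lemma commutator_bilinear_left:
  assumes N: "abelian_normal N" "a \<in> N" "b \<in> N" and g: "g \<in> carrier G"
  shows "commutator G (a \<otimes> b) g = commutator G a g \<otimes> commutator G b g"
proof -
  have carr: "a \<in> carrier G" "b \<in> carrier G"
    using N abelian_normal_carrier by auto
  have "commutator G a g \<otimes> b = b \<otimes> commutator G a g"
    using N g by (intro abelian_normal_commute[of N] abelian_normal_commutator)
  then have "inv b \<otimes> commutator G a g \<otimes> b = commutator G a g"
    using carr g by (simp add: m_assoc inv_mult_cancel)
  then show ?thesis using carr g by (simp add: commutator_mult_left)
qed

lemma commutator_bilinear_right:
  assumes N: "abelian_normal N" "a \<in> N" "b \<in> N" and g: "g \<in> carrier G"
  shows "commutator G g (a \<otimes> b) = commutator G g a \<otimes> commutator G g b"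
proof -
  have carr: "a \<in> carrier G" "b \<in> carrier G"
    using N abelian_normal_carrier by auto
  have "commutator G g (a \<otimes> b) = inv (commutator G a g \<otimes> commutator G b g)"
    using carr g by (simp add: commutator_bilinear_left[OF N g, symmetric] inv_commutator)
  also have "\<dots> = inv (commutator G b g \<otimes> commutator G a g)"
    using abelian_normal_commute[OF N(1)] abelian_normal_commutator[OF N(1)] N g by simp
  also have "\<dots> = commutator G g a \<otimes> commutator G g b"
    using carr g by (simp add: inv_mult_group inv_commutator)
  finally show ?thesis .
qed

lemma commutator_abelian_normal_inv_left:
  assumes N: "abelian_normal N" "a \<in> N" and g: "g \<in> carrier G"
  shows "commutator G (inv a) g = inv (commutator G a g)"
proof -
  have a: "a \<in> carrier G" "inv a \<in> N"
    using N abelian_normal_carrier unfolding abelian_normal_def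
    by (auto simp: normal_imp_subgroup subgroup.m_inv_closed)
  have "commutator G (inv a) g \<otimes> commutator G a g = \<one>"
    using commutator_bilinear_left[OF N(1) a(2) N(2) g] a g by (simp add: commutator_one_left)
  then show ?thesis using a g by (simp add: inv_equality)
qed

section \<open>The subgroups generated by the commutators with a fixed entry\<close>

text \<open>This is \<open>[w,G]\<close>. The generators \<open>[w,g]\<close> alone are not closed under conjugation, but the quotients
  \<open>[w,h]\<^sup>-\<^sup>1[w,g] = (w\<^sup>h)\<^sup>-\<^sup>1w\<^sup>g\<close> are, and they generate the same subgroup.\<close>

definition commutator_subgroup :: "'a \<Rightarrow> 'a set" where
  "commutator_subgroup w =
     generate G {inv (commutator G w h) \<otimes> commutator G w g |g h. g \<in> carrier G \<and> h \<in> carrier G}"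

definition common_entry_law :: bool where
  "common_entry_law \<longleftrightarrow>
     (\<forall>x\<in>carrier G. \<forall>y\<in>carrier G. \<forall>z\<in>carrier G. commutator4 G x y x z = \<one>)"

lemma commutator_subgroup_normal:
  assumes w: "w \<in> carrier G"
  shows "commutator_subgroup w \<lhd> G"
  unfolding commutator_subgroup_def
proof (rule normal_generateI)
  fix a k
  assume "a \<in> {inv (commutator G w h) \<otimes> commutator G w g |g h. g \<in> carrier G \<and> h \<in> carrier G}"
    and k: "k \<in> carrier G"
  then obtain g h where gh: "g \<in> carrier G" "h \<in> carrier G"
    and a: "a = inv (commutator G w h) \<otimes> commutator G w g" by blast
  have "k \<otimes> a \<otimes> inv k
      = inv (commutator G w (h \<otimes> inv k)) \<otimes> commutator G w (g \<otimes> inv k)"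
    using w k gh by (simp add: a word_simps)
  then show "k \<otimes> a \<otimes> inv k
      \<in> {inv (commutator G w h) \<otimes> commutator G w g |g h. g \<in> carrier G \<and> h \<in> carrier G}"
    using k gh by blast
qed (use w in auto)

lemma commutator_in_commutator_subgroup:
  assumes "w \<in> carrier G" "g \<in> carrier G"
  shows "commutator G w g \<in> commutator_subgroup w" "commutator G g w \<in> commutator_subgroup w"
proof -
  have "commutator G w \<one> = \<one>"
    using assms(1) by (simp add: word_simps)
  then have "inv (commutator G w \<one>) \<otimes> commutator G w g = commutator G w g"
    using assms by simp
  then have "\<exists>g' h. commutator G w g = inv (commutator G w h) \<otimes> commutator G w g'
      \<and> g' \<in> carrier G \<and> h \<in> carrier G"
    using assms(2) by (metis one_closed)
  then show 1: "commutator G w g \<in> commutator_subgroup w"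
    unfolding commutator_subgroup_def by (intro generate.incl) blast
  show "commutator G g w \<in> commutator_subgroup w"
    using subgroup.m_inv_closed[OF normal_imp_subgroup[OF commutator_subgroup_normal] 1]
      assms inv_commutator by simp
qed

text \<open>The law makes the generators \<open>[w,g]\<close> commute. The defining generators of \<open>[w,G]\<close> lie in the
  subgroup generated by them, so they commute too.\<close>

lemma commutator_subgroup_abelian_normal:
  assumes law: common_entry_law and w: "w \<in> carrier G"
  shows "abelian_normal (commutator_subgroup w)"
proof -
  let ?S = "{commutator G w g |g. g \<in> carrier G}"
  let ?T = "{inv (commutator G w h) \<otimes> commutator G w g |g h. g \<in> carrier G \<and> h \<in> carrier G}"
  have S: "?S \<subseteq> carrier G" using w by auto
  have "?T \<subseteq> generate G ?S"
    by (auto intro!: generate.eng intro: generate.inv generate.incl)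
  then have "commutator_subgroup w \<subseteq> generate G ?S"
    unfolding commutator_subgroup_def
    using generate_subgroup_incl[OF _ generate_is_subgroup[OF S]] by blast
  moreover have "commutator G a b \<in> {\<one>}" if "a \<in> generate G ?S" "b \<in> generate G ?S" for a b
  proof (rule commutator_generate_in_normal[OF trivial_normal S _ that])
    fix s t assume "s \<in> ?S" "t \<in> ?S"
    then show "commutator G s t \<in> {\<one>}"
      using law w unfolding common_entry_law_def commutator4_def by blast
  qed
  ultimately show ?thesis
    unfolding abelian_normal_def using commutator_subgroup_normal[OF w] by blast
qed

section \<open>Three-generator subgroups\<close>

lemma metabelian_subgroup_iff:
  assumes "subgroup H G"
  shows "metabelian (G\<lparr>carrier := H\<rparr>)
    \<longleftrightarrow> (\<forall>a\<in>derived G H. \<forall>b\<in>derived G H. commutator G a b = \<one>)"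
proof -
  let ?D = "derived G H"
  have D: "subgroup ?D G" "?D \<subseteq> H"
    using derived_is_subgroup[OF subgroup.subset[OF assms]] derived_incl[OF order_refl assms]
    by simp_all
  have carr: "a \<in> carrier G" if "a \<in> ?D" for a
    using subgroup.mem_carrier[OF D(1) that] .
  have "metabelian (G\<lparr>carrier := H\<rparr>) \<longleftrightarrow> derived G ?D = {\<one>}"
    using derived_consistent[OF D(2) assms] derived_consistent[OF order_refl assms]
    by (simp add: metabelian_def)
  also have "\<dots> \<longleftrightarrow> (\<forall>a\<in>?D. \<forall>b\<in>?D. commutator G a b = \<one>)"
  proof
    assume triv: "derived G ?D = {\<one>}"
    have "commutator G a b = \<one>" if ab: "a \<in> ?D" "b \<in> ?D" for a b
    proof -
      have "inv a \<otimes> inv b \<otimes> inv (inv a) \<otimes> inv (inv b) \<in> derived_set G ?D"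
        using ab subgroup.m_inv_closed[OF D(1)] by blast
      then have "commutator G a b \<in> derived_set G ?D"
        unfolding commutator_def inv_inv[OF carr[OF ab(1)]] inv_inv[OF carr[OF ab(2)]] .
      then have "commutator G a b \<in> derived G ?D"
        unfolding derived_def by (rule generate.incl)
      then show ?thesis using triv by simp
    qed
    then show "\<forall>a\<in>?D. \<forall>b\<in>?D. commutator G a b = \<one>" by blast
  next
    assume "\<forall>a\<in>?D. \<forall>b\<in>?D. commutator G a b = \<one>"
    moreover have "generate G ?D = ?D"
      using D(1) by (metis generate_incl generate_subgroup_incl generate.incl order_refl
          subgroup.subset subset_antisym subsetI)
    ultimately have "derived G ?D \<subseteq> {\<one>}"
      using derived_generate_subset_normal[OF trivial_normal, of ?D] carr by auto
    moreover have "\<one> \<in> derived G ?D"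
      by (simp add: derived_def generate.one)
    ultimately show "derived G ?D = {\<one>}" by blast
  qed
  finally show ?thesis .
qed

text \<open>The set \<open>T\<close> collects the pairwise intersections of \<open>[x,G]\<close>, \<open>[y,G]\<close>, \<open>[z,G]\<close>. It is closed under
  conjugation, and it is commutative because two of the three intersections always lie in a common
  factor. So it generates an abelian normal subgroup, and that subgroup contains \<open>[x,y]\<close>, \<open>[y,z]\<close>
  and \<open>[z,x]\<close>.\<close>

lemma law_imp_three_metabelian:
  assumes law: common_entry_law
  shows "three_metabelian G"
  unfolding three_metabelian_def
proof (intro ballI)
  fix x y z assume xyz: "x \<in> carrier G" "y \<in> carrier G" "z \<in> carrier G"
  let ?N = commutator_subgroup
  let ?T = "(?N x \<inter> ?N y) \<union> (?N y \<inter> ?N z) \<union> (?N z \<inter> ?N x)"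
  let ?H = "generate G {x, y, z}"
  note ab = commutator_subgroup_abelian_normal[OF law]
  have T: "?T \<subseteq> carrier G"
    using xyz ab abelian_normal_carrier by blast
  have conj: "g \<otimes> a \<otimes> inv g \<in> ?N w" if "a \<in> ?N w" "g \<in> carrier G" "w \<in> carrier G" for a g w
    using normal.inv_op_closed2[OF commutator_subgroup_normal] that by blast
  have P: "generate G ?T \<lhd> G"
    using T by (rule normal_generateI) (use conj xyz in blast)
  have "commutator G s t \<in> generate G ?T" if "s \<in> {x, y, z}" "t \<in> {x, y, z}" for s t
  proof (cases "s = t")
    case True
    then have "commutator G s t = \<one>"
      using that xyz by (auto simp: commutator_eq_one_iff)
    then show ?thesis by (simp add: generate.one)
  next
    case False
    have "commutator G s t \<in> ?N s \<inter> ?N t"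
      using that xyz commutator_in_commutator_subgroup by blast
    then show ?thesis
      using that False by (auto intro!: generate.incl)
  qed
  then have D: "derived G ?H \<subseteq> generate G ?T"
    using xyz by (intro derived_generate_subset_normal[OF P]) auto
  have "commutator G a b \<in> {\<one>}" if "a \<in> generate G ?T" "b \<in> generate G ?T" for a b
  proof (rule commutator_generate_in_normal[OF trivial_normal T _ that])
    fix s t assume "s \<in> ?T" "t \<in> ?T"
    then obtain w where "w \<in> {x, y, z}" "s \<in> ?N w" "t \<in> ?N w" by blast
    then show "commutator G s t \<in> {\<one>}"
      using ab xyz unfolding abelian_normal_def by blast
  qed
  moreover have "subgroup ?H G"
    using xyz by (intro generate_is_subgroup) auto
  ultimately show "metabelian (G\<lparr>carrier := ?H\<rparr>)"
    using D by (auto simp: metabelian_subgroup_iff)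
qed

lemma three_metabelian_imp_law:
  assumes "three_metabelian G"
  shows common_entry_law
  unfolding common_entry_law_def commutator4_def
proof (intro ballI)
  fix x y z assume xyz: "x \<in> carrier G" "y \<in> carrier G" "z \<in> carrier G"
  let ?H = "generate G {x, y, z}"
  have H: "subgroup ?H G"
    using xyz by (intro generate_is_subgroup) auto
  have in_derived: "commutator G s t \<in> derived G ?H" if st: "s \<in> {x, y, z}" "t \<in> {x, y, z}" for s t
  proof -
    have "s \<in> carrier G" "t \<in> carrier G" using st xyz by auto
    moreover have "inv s \<in> ?H" "inv t \<in> ?H"
      using st by (auto intro: generate.inv)
    then have "inv s \<otimes> inv t \<otimes> inv (inv s) \<otimes> inv (inv t) \<in> derived_set G ?H" by blast
    ultimately have "commutator G s t \<in> derived_set G ?H"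
      by (simp only: commutator_def inv_inv)
    then show ?thesis
      unfolding derived_def by (rule generate.incl)
  qed
  have "metabelian (G\<lparr>carrier := ?H\<rparr>)"
    using assms xyz unfolding three_metabelian_def by blast
  then show "commutator G (commutator G x y) (commutator G x z) = \<one>"
    using in_derived metabelian_subgroup_iff[OF H] by blast
qed

section \<open>Exchanging entries\<close>

lemma commutator4_exchange_12:
  assumes law: common_entry_law
    and "w \<in> carrier G" "x \<in> carrier G" "y \<in> carrier G" "z \<in> carrier G"
  shows "commutator4 G x w y z = inv (commutator4 G w x y z)"
  using commutator_abelian_normal_inv_left[OF commutator_subgroup_abelian_normal[OF law],
      of w "commutator G w x" "commutator G y z"] assms
  by (simp add: commutator4_def inv_commutator commutator_in_commutator_subgroup)

text \<open>Linearisation of \<open>[xw,y;xw,z] = 1\<close>. With \<open>c = [x,y]\<close> and \<open>e = [x,z]\<close> one has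
  \<open>[xw,y] = c[c,w][w,y]\<close> and \<open>[xw,z] = e[e,w][w,z]\<close>. The factors of the first product lie in \<open>[y,G]\<close>
  and those of the second in \<open>[z,G]\<close>, so the commutator expands bilinearly into nine terms. Here \<open>c\<close> and
  \<open>e\<close> lie in \<open>[x,G]\<close>, \<open>[w,y]\<close> and \<open>[w,z]\<close> lie in \<open>[w,G]\<close>, and the correction factors \<open>[c,w]\<close> and
  \<open>[e,w]\<close> lie in both, so only \<open>[x,y;w,z]\<close> and \<open>[w,y;x,z]\<close> survive.\<close>

lemma commutator4_exchange_13:
  assumes law: common_entry_law
    and carr: "w \<in> carrier G" "x \<in> carrier G" "y \<in> carrier G" "z \<in> carrier G"
  shows "commutator4 G x y w z = inv (commutator4 G w y x z)"
proof -
  let ?N = commutator_subgroup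
  define c where "c = commutator G x y"
  define c' where "c' = commutator G c w"
  define B where "B = commutator G w y"
  define e where "e = commutator G x z"
  define e' where "e' = commutator G e w"
  define D where "D = commutator G w z"
  note ab = commutator_subgroup_abelian_normal[OF law]
  have comm: "commutator G a b = \<one>" if "a \<in> ?N u" "b \<in> ?N u" "u \<in> carrier G" for a b u
    using ab[OF that(3)] that unfolding abelian_normal_def by blast
  have in_carrier: "c \<in> carrier G" "c' \<in> carrier G" "B \<in> carrier G"
      "e \<in> carrier G" "e' \<in> carrier G" "D \<in> carrier G"
    using carr by (simp_all add: c_def c'_def B_def e_def e'_def D_def)
  note [simp] = in_carrier
  have mem: "c \<in> ?N x" "c \<in> ?N y" "e \<in> ?N x" "e \<in> ?N z"
      "B \<in> ?N w" "B \<in> ?N y" "D \<in> ?N w" "D \<in> ?N z" "c' \<in> ?N w" "e' \<in> ?N w"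
    using carr in_carrier(1,4)
    by (simp_all add: c_def c'_def B_def e_def e'_def D_def commutator_in_commutator_subgroup)
  then have mem': "c' \<in> ?N x" "c' \<in> ?N y" "e' \<in> ?N x" "e' \<in> ?N z"
    using carr unfolding c'_def e'_def by (auto intro!: abelian_normal_commutator ab)
  note mem = mem mem'
  have mult: "a \<otimes> b \<in> ?N u" if "a \<in> ?N u" "b \<in> ?N u" "u \<in> carrier G" for a b u
    using subgroup.m_closed[OF normal_imp_subgroup[OF commutator_subgroup_normal]] that by blast
  have y: "commutator G (x \<otimes> w) y = c \<otimes> c' \<otimes> B"
    using carr by (simp add: c_def c'_def B_def word_simps)
  have z: "commutator G (x \<otimes> w) z = e \<otimes> e' \<otimes> D"
    using carr by (simp add: e_def e'_def D_def word_simps)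
  have left: "commutator G (c \<otimes> c' \<otimes> B) g
      = commutator G c g \<otimes> commutator G c' g \<otimes> commutator G B g" if "g \<in> carrier G" for g
    using that carr mem mult commutator_bilinear_left[OF ab[of y]] by simp
  have right: "commutator G g (e \<otimes> e' \<otimes> D)
      = commutator G g e \<otimes> commutator G g e' \<otimes> commutator G g D" if "g \<in> carrier G" for g
    using that carr mem mult commutator_bilinear_right[OF ab[of z]] by simp
  have vanish: "commutator G c e = \<one>" "commutator G c e' = \<one>" "commutator G c' e = \<one>"
      "commutator G c' e' = \<one>" "commutator G c' D = \<one>" "commutator G B e' = \<one>"
      "commutator G B D = \<one>"
    using comm mem carr by blast+
  have "\<one> = commutator G (c \<otimes> c' \<otimes> B) (e \<otimes> e' \<otimes> D)"
    using law carr unfolding common_entry_law_def commutator4_def by (simp flip: y z)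
  also have "\<dots> = commutator G c D \<otimes> commutator G B e"
    by (subst left) (simp_all add: right vanish)
  finally have "commutator G c D \<otimes> commutator G B e = \<one>" by simp
  then have "commutator G c D = inv (commutator G B e)"
    by (metis commutator_closed in_carrier inv_equality)
  then show ?thesis
    by (simp add: commutator4_def c_def B_def e_def D_def)
qed

text \<open>The transposition \<open>(2 3)\<close> equals \<open>(1 2)(1 3)(1 2)\<close>, and each of the three factors inverts.\<close>

lemma commutator4_interchange:
  assumes law: common_entry_law
    and "w \<in> carrier G" "x \<in> carrier G" "y \<in> carrier G" "z \<in> carrier G"
  shows "commutator4 G w x y z = inv (commutator4 G w y x z)"
  using assms commutator4_exchange_12[OF law, of x w y z]
    commutator4_exchange_13[OF law, of y x w z] commutator4_exchange_12[OF law, of w y x z]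
  by (simp add: commutator4_def)

lemma interchange_imp_law:
  assumes "interchange_law G"
  shows common_entry_law
  unfolding common_entry_law_def
proof (intro ballI)
  fix x y z assume xyz: "x \<in> carrier G" "y \<in> carrier G" "z \<in> carrier G"
  have "commutator4 G x y x z = commutator4 G x x y z"
    using assms xyz unfolding interchange_law_def by blast
  also have "\<dots> = \<one>"
  proof -
    have "commutator G x x = \<one>"
      using xyz by (simp add: commutator_eq_one_iff)
    then show ?thesis
      using xyz by (simp add: commutator4_def commutator_one_left)
  qed
  finally show "commutator4 G x y x z = \<one>" .
qed

lemma eq_inv_iff_square_eq_one:
  assumes "a \<in> carrier G"
  shows "a = inv a \<longleftrightarrow> a [^] (2::nat) = \<one>"
  using assms by (metis inv_equality nat_pow_Suc nat_pow_0 l_one r_inv numeral_2_eq_2)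

lemma interchange_law_iff:
  "interchange_law G \<longleftrightarrow> common_entry_law \<and>
    (\<forall>w\<in>carrier G. \<forall>x\<in>carrier G. \<forall>y\<in>carrier G. \<forall>z\<in>carrier G.
       commutator4 G w x y z [^] (2::nat) = \<one>)"
proof -
  have "commutator4 G w x y z = commutator4 G w y x z
      \<longleftrightarrow> commutator4 G w x y z [^] (2::nat) = \<one>"
    if law: common_entry_law
      and wxyz: "w \<in> carrier G" "x \<in> carrier G" "y \<in> carrier G" "z \<in> carrier G" for w x y z
  proof -
    have carr: "commutator4 G w x y z \<in> carrier G" "commutator4 G w y x z \<in> carrier G"
      using wxyz by (simp_all add: commutator4_def)
    have "commutator4 G w y x z = inv (commutator4 G w x y z)"
      using commutator4_interchange[OF law] wxyz by blast
    then show ?thesis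
      using eq_inv_iff_square_eq_one[OF carr(1)] by simp
  qed
  then show ?thesis
    using interchange_imp_law unfolding interchange_law_def by blast
qed

lemma square_eq_one_iff_ord:
  assumes a: "a \<in> carrier G"
  shows "a [^] (2::nat) = \<one> \<longleftrightarrow> a = \<one> \<or> ord a = 2"
proof -
  have "a [^] (2::nat) = \<one> \<longleftrightarrow> ord a dvd 2"
    using a by (rule pow_eq_id)
  also have "\<dots> \<longleftrightarrow> ord a = 1 \<or> ord a = 2"
    using two_is_prime_nat prime_nat_iff by auto
  finally show ?thesis using ord_eq_1[OF a] by simp
qed

end

section \<open>The commutator interchange law\<close>

theorem theorem1p6:
  fixes G :: "('a, 'b) monoid_scheme"
  assumes "group G"
  shows "(interchange_law G \<longleftrightarrow>
            three_metabelian G \<and>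
            (\<forall>w\<in>carrier G. \<forall>x\<in>carrier G. \<forall>y\<in>carrier G. \<forall>z\<in>carrier G.
               commutator4 G w x y z = \<one>\<^bsub>G\<^esub> \<or> group.ord G (commutator4 G w x y z) = 2))
       \<and> (interchange_law G \<longleftrightarrow>
            (\<forall>x\<in>carrier G. \<forall>y\<in>carrier G. \<forall>z\<in>carrier G. commutator4 G x y x z = \<one>\<^bsub>G\<^esub>) \<and>
            (\<forall>w\<in>carrier G. \<forall>x\<in>carrier G. \<forall>y\<in>carrier G. \<forall>z\<in>carrier G.
               commutator4 G w x y z [^]\<^bsub>G\<^esub> (2::nat) = \<one>\<^bsub>G\<^esub>))"
proof -
  interpret group G by fact
  have closed: "commutator4 G w x y z \<in> carrier G"
    if "w \<in> carrier G" "x \<in> carrier G" "y \<in> carrier G" "z \<in> carrier G" for w x y z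
    using that by (simp add: commutator4_def)
  have "common_entry_law \<longleftrightarrow> three_metabelian G"
    using law_imp_three_metabelian three_metabelian_imp_law by blast
  then show ?thesis
    using interchange_law_iff closed square_eq_one_iff_ord
    unfolding common_entry_law_def by simp
qed

end
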